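(* Let $k\in\mathbb{N}$, let $\mathcal{G}$ be a graph class (with a membership test) all of whose members have at least $k+1$ vertices, and let $\mathcal{U}$ be a finite set of graphs. The answer returned by the algorithm Test-Unavoidable-Structures$(\mathcal{G},\mathcal{U},k)$ (described in the context) is correct, that is: if the algorithm returns a graph, then this graph is an element of $\mathcal{G}^k\setminus \mathrm{super}(\mathcal{U})$; and if the algorithm returns NONE, then $\mathcal{G}^k\subseteq \mathrm{super}(\mathcal{U})$.
   Context: Graphs are non-empty, finite and simple; graph classes are closed under isomorphism. A path-decomposition of $G$ is a sequence of bags $V_1,\dots,V_{n'}\subseteq V(G)$ such that every vertex lies in some bag, both ends of every edge lie together in some bag, and for each vertex the indices of the bags containing it form an interval. Its width is $\max_i|V_i|-1$; path-width $\mathrm{pw}(G)$ is the minimum width. A path-decomposition of width $k$ is smooth if all bags have $k+1$ elements and $|V_i\cap V_{i+1}|=k$ for $1\le i<n'$. The graph associated with $V_i$ is $G_i := G[\bigcup_{1\le j\le i}V_j]-E(G[V_i])$. $\mathcal{G}^k:=\{G\in\mathcal{G}: \mathrm{pw}(G)\le k\}$; $\mathrm{super}(\mathcal{U})$ is the class of all graphs that contain a subgraph isomorphic to some member of $\mathcal{U}$. For a smooth path-decomposition (of width $k$) of $G$ with bags $V_1,\dots,V_{n'}$ and each $i$, we say that $G$ contains the pair $(V_i,G_i)$. A pair $(U,H)$ is good if every $G\in\mathcal{G}^k$ containing it satisfies $G\in\mathrm{super}(\mathcal{U})$. Algorithm Test-Unavoidable-Structures$(\mathcal{G},\mathcal{U},k)$,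 with vertices named $u_1,\dots,u_k,v_1,v_2,\dots$: 1. Set $V_1:=\{u_1,\dots,u_k,v_1\}$ and initialise a queue $Q$ with the single pair $(V_1,(V_1,\emptyset))$, where $(V_1,\emptyset)$ is the edgeless graph on $V_1$. If this pair is good, remove it from $Q$. 2. While $Q$ is not empty: remove a pair $(U,H)$ from $Q$. (a) For each $E'\subseteq\{xy: x,y\in U, x\ne y\}$: if $H+E'\in\mathcal{G}\setminus\mathrm{super}(\mathcal{U})$, return $H+E'$ and stop. (b) Let $i=|V(H)|-k$. For each $u\in U$, set $U':=(U\setminus\{u\})\cup\{v_{i+1}\}$, and for each $Y\subseteq U\setminus\{u\}$ set $H':=H+v_{i+1}+\{uy: y\in Y\}$ (add the new vertex $v_{i+1}$ and the edges $uy$). If $H'\notin\mathrm{super}(\mathcal{U})$ and there exists $G\in\mathcal{G}$ containing $(U',H')$, append $(U',H')$ to $Q$. 3. Return NONE. *)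

theory Defs
  imports Main
begin

section \<open>Finite simple graphs\<close>

text \<open>A graph is a pair of a vertex set and a set of edges, an edge being a two-element set of vertices.\<close>

type_synonym 'a graph = "'a set \<times> 'a set set"

abbreviation verts :: "'a graph \<Rightarrow> 'a set" where "verts \<equiv> fst"
abbreviation edges :: "'a graph \<Rightarrow> 'a set set" where "edges \<equiv> snd"

definition pairs_of :: "'a set \<Rightarrow> 'a set set" where
  "pairs_of S = {{x, y} | x y. x \<in> S \<and> y \<in> S \<and> x \<noteq> y}"

definition is_graph :: "'a graph \<Rightarrow> bool" where
  "is_graph G \<longleftrightarrow> finite (verts G) \<and> verts G \<noteq> {} \<and> edges G \<subseteq> pairs_of (verts G)"

definition graph_iso :: "'a graph \<Rightarrow> 'b graph \<Rightarrow> bool" where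
  "graph_iso G H \<longleftrightarrow>
     (\<exists>f. bij_betw f (verts G) (verts H) \<and> edges H = (\<lambda>e. f ` e) ` edges G)"

definition subgraph :: "'a graph \<Rightarrow> 'a graph \<Rightarrow> bool" where
  "subgraph S G \<longleftrightarrow> is_graph S \<and> verts S \<subseteq> verts G \<and> edges S \<subseteq> edges G"

definition induced :: "'a graph \<Rightarrow> 'a set \<Rightarrow> 'a graph" where
  "induced G S = (S, {e \<in> edges G. e \<subseteq> S})"

definition add_edges :: "'a graph \<Rightarrow> 'a set set \<Rightarrow> 'a graph" where
  "add_edges G F = (verts G, edges G \<union> F)"

definition del_edges :: "'a graph \<Rightarrow> 'a set set \<Rightarrow> 'a graph" where
  "del_edges G F = (verts G, edges G - F)"

definition add_vertex :: "'a graph \<Rightarrow> 'a \<Rightarrow> 'a graph" where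
  "add_vertex G x = (insert x (verts G), edges G)"

definition graph_class :: "'a graph set \<Rightarrow> bool" where
  "graph_class \<G> \<longleftrightarrow>
     (\<forall>G\<in>\<G>. is_graph G) \<and> (\<forall>G\<in>\<G>. \<forall>H. is_graph H \<and> graph_iso G H \<longrightarrow> H \<in> \<G>)"

definition super :: "'a graph set \<Rightarrow> 'a graph set" where
  "super \<U> = {G. is_graph G \<and> (\<exists>S. subgraph S G \<and> (\<exists>X\<in>\<U>. graph_iso X S))}"

section \<open>Path-decompositions\<close>

text \<open>The bags are listed from index 0, so \<open>Vs ! i\<close> is the bag \<open>V\<^sub>i\<^sub>+\<^sub>1\<close> of the usual 1-based numbering.\<close>

definition path_decomposition :: "'a graph \<Rightarrow> 'a set list \<Rightarrow> bool" where
  "path_decomposition G Vs \<longleftrightarrow>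
     (\<forall>B\<in>set Vs. B \<subseteq> verts G) \<and>
     (\<forall>x\<in>verts G. \<exists>B\<in>set Vs. x \<in> B) \<and>
     (\<forall>e\<in>edges G. \<exists>B\<in>set Vs. e \<subseteq> B) \<and>
     (\<forall>x\<in>verts G. \<forall>i j l. i \<le> j \<and> j \<le> l \<and> l < length Vs \<and> x \<in> Vs ! i \<and> x \<in> Vs ! l
        \<longrightarrow> x \<in> Vs ! j)"

text \<open>Graphs being non-empty, every path-decomposition has a non-empty bag; hence the maximum
  below is taken over a non-empty set and is positive, and the subtraction does not truncate.\<close>

definition pd_width :: "'a set list \<Rightarrow> nat" where
  "pd_width Vs = Max (card ` set Vs) - 1"

definition path_width :: "'a graph \<Rightarrow> nat" where
  "path_width G = (LEAST w. \<exists>Vs. path_decomposition G Vs \<and> pd_width Vs = w)"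

definition pw_at_most :: "'a graph set \<Rightarrow> nat \<Rightarrow> 'a graph set" where
  "pw_at_most \<G> k = {G \<in> \<G>. path_width G \<le> k}"

definition smooth_pd :: "nat \<Rightarrow> 'a graph \<Rightarrow> 'a set list \<Rightarrow> bool" where
  "smooth_pd k G Vs \<longleftrightarrow>
     path_decomposition G Vs \<and> pd_width Vs = k \<and>
     (\<forall>B\<in>set Vs. card B = k + 1) \<and>
     (\<forall>i. i + 1 < length Vs \<longrightarrow> card (Vs ! i \<inter> Vs ! (i + 1)) = k)"

definition assoc_graph :: "'a graph \<Rightarrow> 'a set list \<Rightarrow> nat \<Rightarrow> 'a graph" where
  "assoc_graph G Vs i =
     del_edges (induced G (\<Union>j\<le>i. Vs ! j)) (edges (induced G (Vs ! i)))"

definition contains_pair :: "nat \<Rightarrow> 'a graph \<Rightarrow> 'a set \<times> 'a graph \<Rightarrow> bool" where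
  "contains_pair k G P \<longleftrightarrow>
     (\<exists>Vs i. smooth_pd k G Vs \<and> i < length Vs \<and> P = (Vs ! i, assoc_graph G Vs i))"

definition good_pair ::
  "'a graph set \<Rightarrow> 'a graph set \<Rightarrow> nat \<Rightarrow> 'a set \<times> 'a graph \<Rightarrow> bool" where
  "good_pair \<G> \<U> k P \<longleftrightarrow> (\<forall>G \<in> pw_at_most \<G> k. contains_pair k G P \<longrightarrow> G \<in> super \<U>)"

section \<open>The algorithm Test-Unavoidable-Structures\<close>

text \<open>The vertex names are given by two functions \<open>un\<close> and \<open>vn\<close>: \<open>un j\<close> is \<open>u\<^sub>j\<close> and \<open>vn j\<close> is
  \<open>v\<^sub>j\<close>, both 1-based.\<close>

definition extend_pair ::
  "(nat \<Rightarrow> 'a) \<Rightarrow> nat \<Rightarrow> 'a set \<times> 'a graph \<Rightarrow> 'a \<times> 'a set \<Rightarrow> 'a set \<times> 'a graph" where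
  "extend_pair vn k = (\<lambda>(U, H) (u, Y).
     let i = card (verts H) - k; x = vn (i + 1)
     in (insert x (U - {u}), add_edges (add_vertex H x) {{u, y} | y. y \<in> Y}))"

definition keep_pair ::
  "'a graph set \<Rightarrow> 'a graph set \<Rightarrow> nat \<Rightarrow> 'a set \<times> 'a graph \<Rightarrow> bool" where
  "keep_pair \<G> \<U> k P \<longleftrightarrow> snd P \<notin> super \<U> \<and> (\<exists>G\<in>\<G>. contains_pair k G P)"

text \<open>\<open>tus_loop vn \<G> \<U> k Q r\<close>: some execution of the while-loop started with queue \<open>Q\<close> (head
  first) terminates with answer \<open>r\<close>, where \<open>None\<close> is the answer NONE. The order in which the
  for-each loops run through their ranges is not specified by the algorithm and is left open:
  any edge set \<open>E'\<close> that passes the test may be the one returned, and the choices \<open>(u, Y)\<close> may be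
  enumerated, once each, by any list \<open>cs\<close>.\<close>

inductive tus_loop ::
  "(nat \<Rightarrow> 'a) \<Rightarrow> 'a graph set \<Rightarrow> 'a graph set \<Rightarrow> nat \<Rightarrow>
   ('a set \<times> 'a graph) list \<Rightarrow> 'a graph option \<Rightarrow> bool"
  for vn :: "nat \<Rightarrow> 'a" and \<G> \<U> :: "'a graph set" and k :: nat
where
  empty_queue: "tus_loop vn \<G> \<U> k [] None"
| return_graph:
    "\<lbrakk> E' \<subseteq> pairs_of U; add_edges H E' \<in> \<G> - super \<U> \<rbrakk>
     \<Longrightarrow> tus_loop vn \<G> \<U> k ((U, H) # Q) (Some (add_edges H E'))"
| extend:
    "\<lbrakk> \<forall>E' \<subseteq> pairs_of U. add_edges H E' \<notin> \<G> - super \<U>;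
       distinct cs; set cs = {(u, Y). u \<in> U \<and> Y \<subseteq> U - {u}};
       tus_loop vn \<G> \<U> k (Q @ filter (keep_pair \<G> \<U> k) (map (extend_pair vn k (U, H)) cs)) r \<rbrakk>
     \<Longrightarrow> tus_loop vn \<G> \<U> k ((U, H) # Q) r"

definition initial_pair :: "(nat \<Rightarrow> 'a) \<Rightarrow> (nat \<Rightarrow> 'a) \<Rightarrow> nat \<Rightarrow> 'a set \<times> 'a graph" where
  "initial_pair un vn k = (let V1 = insert (vn 1) (un ` {1..k}) in (V1, (V1, {})))"

definition tus_returns ::
  "(nat \<Rightarrow> 'a) \<Rightarrow> (nat \<Rightarrow> 'a) \<Rightarrow> 'a graph set \<Rightarrow> 'a graph set \<Rightarrow> nat \<Rightarrow>
   'a graph option \<Rightarrow> bool" where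
  "tus_returns un vn \<G> \<U> k r \<longleftrightarrow>
     tus_loop vn \<G> \<U> k
       (if good_pair \<G> \<U> k (initial_pair un vn k) then [] else [initial_pair un vn k]) r"

end

theory Submission
  imports Defs
begin

text \<open>Soundness: every queued pair \<open>(U, H)\<close> is contained in some member of \<open>\<G>\<close>, and the bags up to
  \<open>U\<close> of the witnessing decomposition form a path-decomposition of \<open>H + E'\<close>. Completeness: a member
  of \<open>\<G>\<^sup>k\<close> outside \<open>super \<U>\<close> has a smooth path-decomposition, and after renaming its vertices the
  algorithm introduces them in exactly the order of the bags. Then all pairs of this decomposition
  pass the filter, so a run answering NONE would have to process every one of them; but processing
  the last pair returns a graph.\<close>

section \<open>Isomorphic copies\<close>

definition image_graph :: "('a \<Rightarrow> 'b) \<Rightarrow> 'a graph \<Rightarrow> 'b graph" where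
  "image_graph f G = (f ` verts G, (\<lambda>e. f ` e) ` edges G)"

lemma verts_image_graph [simp]: "verts (image_graph f G) = f ` verts G"
  and edges_image_graph [simp]: "edges (image_graph f G) = (\<lambda>e. f ` e) ` edges G"
  by (simp_all add: image_graph_def)

lemma pairs_of_subset: "e \<in> pairs_of S \<Longrightarrow> e \<subseteq> S"
  by (auto simp: pairs_of_def)

lemma pairs_of_restrict: "e \<in> pairs_of S \<Longrightarrow> e \<subseteq> T \<Longrightarrow> e \<in> pairs_of T"
  by (auto simp: pairs_of_def)

lemma is_graph_edge_subset: "is_graph G \<Longrightarrow> e \<in> edges G \<Longrightarrow> e \<subseteq> verts G"
  unfolding is_graph_def using pairs_of_subset by blast

lemma is_graph_image_graph:
  assumes "is_graph G" and "inj_on f (verts G)"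
  shows "is_graph (image_graph f G)"
proof -
  have "f ` e \<in> pairs_of (f ` verts G)" if "e \<in> edges G" for e
  proof -
    have "e \<in> pairs_of (verts G)" using assms(1) that unfolding is_graph_def by blast
    then obtain x y where e: "e = {x, y}" "x \<in> verts G" "y \<in> verts G" "x \<noteq> y"
      unfolding pairs_of_def by blast
    then have "f x \<noteq> f y" using assms(2) by (meson inj_onD)
    then show ?thesis using e unfolding pairs_of_def by fast
  qed
  then have "(\<lambda>e. f ` e) ` edges G \<subseteq> pairs_of (f ` verts G)" by (rule image_subsetI)
  then show ?thesis using assms(1) by (simp add: is_graph_def)
qed

lemma graph_iso_image_graph: "inj_on f (verts G) \<Longrightarrow> graph_iso G (image_graph f G)"
  unfolding graph_iso_def by (intro exI[of _ f]) (simp add: inj_on_imp_bij_betw)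

lemma graph_iso_trans:
  assumes "graph_iso G H" and "graph_iso H K"
  shows "graph_iso G K"
proof -
  obtain f g where "bij_betw f (verts G) (verts H)" "edges H = (\<lambda>e. f ` e) ` edges G"
    "bij_betw g (verts H) (verts K)" "edges K = (\<lambda>e. g ` e) ` edges H"
    using assms by (auto simp: graph_iso_def)
  then show ?thesis unfolding graph_iso_def
    by (intro exI[of _ "g \<circ> f"]) (simp add: bij_betw_trans image_image image_comp)
qed

section \<open>Unavoidable structures in supergraphs and in isomorphic copies\<close>

lemma super_mono:
  assumes "H \<in> super \<U>" and "is_graph G" and "verts H \<subseteq> verts G" and "edges H \<subseteq> edges G"
  shows "G \<in> super \<U>"
  using assms unfolding super_def subgraph_def by blast

text \<open>The inverse of \<open>f\<close> carries a copy of \<open>X\<close> inside the image back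
  to a copy inside \<open>G\<close>. This returns the conclusion for a renamed graph to the original
  one.\<close>

lemma super_image_graphD:
  assumes G: "is_graph G" and f: "inj_on f (verts G)" and sup: "image_graph f G \<in> super \<U>"
  shows "G \<in> super \<U>"
proof -
  obtain S X where S: "is_graph S" "verts S \<subseteq> f ` verts G" "edges S \<subseteq> (\<lambda>e. f ` e) ` edges G"
    and X: "X \<in> \<U>" "graph_iso X S"
    using sup unfolding super_def subgraph_def by force
  define g where "g = inv_into (verts G) f"
  have g: "inj_on g (verts S)" using inj_on_inv_into[OF S(2)] by (simp add: g_def)
  have gf: "g ` f ` A = A" if "A \<subseteq> verts G" for A
    unfolding g_def using inv_into_image_cancel[OF f that] .
  have "verts (image_graph g S) \<subseteq> verts G"
    using image_mono[OF S(2), of g] gf[OF subset_refl] by simp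
  moreover have "edges (image_graph g S) \<subseteq> edges G"
  proof
    fix e assume "e \<in> edges (image_graph g S)"
    then have "\<exists>d\<in>edges S. e = g ` d" by (simp add: image_iff)
    then obtain d where d: "d \<in> edges S" "e = g ` d" by blast
    then have "\<exists>c\<in>edges G. d = f ` c" using S(3) by (simp add: image_iff subset_iff)
    then show "e \<in> edges G" using d(2) gf is_graph_edge_subset[OF G] by metis
  qed
  moreover have "is_graph (image_graph g S)" by (rule is_graph_image_graph[OF S(1) g])
  moreover have "graph_iso X (image_graph g S)"
    using graph_iso_trans[OF X(2) graph_iso_image_graph[OF g]] .
  ultimately show ?thesis using G X(1) unfolding super_def subgraph_def by blast
qed

section \<open>Smooth path-decompositions\<close>

text \<open>The interval condition for a list of bags alone, without a graph, so that bags can be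
  altered freely in an induction.\<close>

definition interval_bags :: "'a set list \<Rightarrow> bool" where
  "interval_bags Vs \<longleftrightarrow> (\<forall>i j l. i \<le> j \<and> j \<le> l \<and> l < length Vs \<longrightarrow> Vs ! i \<inter> Vs ! l \<subseteq> Vs ! j)"

lemma interval_bagsD:
  "interval_bags Vs \<Longrightarrow> i \<le> j \<Longrightarrow> j \<le> l \<Longrightarrow> l < length Vs \<Longrightarrow> x \<in> Vs ! i \<Longrightarrow> x \<in> Vs ! l \<Longrightarrow> x \<in> Vs ! j"
  unfolding interval_bags_def by blast

text \<open>Recursive form for list induction: a vertex of a new front bag that occurs again must do
  so without a gap, hence already in the next bag.\<close>

lemma interval_bags_Cons:
  assumes "Bs \<noteq> []"
  shows "interval_bags (B # Bs) \<longleftrightarrow> interval_bags Bs \<and> B \<inter> \<Union>(set Bs) \<subseteq> hd Bs"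
proof
  assume *: "interval_bags (B # Bs)"
  have "interval_bags Bs"
    unfolding interval_bags_def
  proof (intro allI impI)
    fix i j l assume "i \<le> j \<and> j \<le> l \<and> l < length Bs"
    then show "Bs ! i \<inter> Bs ! l \<subseteq> Bs ! j"
      using interval_bagsD[OF *, of "Suc i" "Suc j" "Suc l"] by auto
  qed
  moreover have "B \<inter> \<Union>(set Bs) \<subseteq> hd Bs"
  proof
    fix x assume "x \<in> B \<inter> \<Union>(set Bs)"
    then obtain l where "x \<in> B" "l < length Bs" "x \<in> Bs ! l" by (auto simp: in_set_conv_nth)
    then show "x \<in> hd Bs"
      using interval_bagsD[OF *, of 0 1 "Suc l"] assms by (auto simp: hd_conv_nth)
  qed
  ultimately show "interval_bags Bs \<and> B \<inter> \<Union>(set Bs) \<subseteq> hd Bs" ..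
next
  assume *: "interval_bags Bs \<and> B \<inter> \<Union>(set Bs) \<subseteq> hd Bs"
  show "interval_bags (B # Bs)"
    unfolding interval_bags_def
  proof (intro allI impI)
    fix i j l assume ijl: "i \<le> j \<and> j \<le> l \<and> l < length (B # Bs)"
    show "(B # Bs) ! i \<inter> (B # Bs) ! l \<subseteq> (B # Bs) ! j"
    proof (cases j)
      case 0
      then show ?thesis using ijl by auto
    next
      case (Suc j')
      then obtain l' where l': "l = Suc l'" "j' \<le> l'" "l' < length Bs"
        using ijl by (cases l) auto
      show ?thesis
      proof (cases i)
        case 0
        have "B \<inter> Bs ! l' \<subseteq> Bs ! 0"
          using * nth_mem[OF l'(3)] unfolding hd_conv_nth[OF assms] by blast
        then show ?thesis
          using interval_bagsD[of Bs 0 j' l'] * l' 0 Suc by auto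
      next
        case (Suc i')
        then show ?thesis
          using interval_bagsD[of Bs i' j' l'] * l' ijl \<open>j = Suc j'\<close> by auto
      qed
    qed
  qed
qed

text \<open>The part of \<open>smooth_pd\<close> that concerns bags only. Non-emptiness is included
  so that the width can be read off from the common bag size.\<close>

definition smooth_bags :: "nat \<Rightarrow> 'a set list \<Rightarrow> bool" where
  "smooth_bags k Vs \<longleftrightarrow> Vs \<noteq> [] \<and> interval_bags Vs \<and> (\<forall>B\<in>set Vs. card B = k + 1) \<and>
     (\<forall>i. i + 1 < length Vs \<longrightarrow> card (Vs ! i \<inter> Vs ! (i + 1)) = k)"

lemma smooth_bags_singleton: "card B = k + 1 \<Longrightarrow> smooth_bags k [B]"
  by (simp add: smooth_bags_def interval_bags_def)

lemma smooth_bags_Cons: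
  assumes "smooth_bags k Ws" and "card B = k + 1" and "card (B \<inter> hd Ws) = k"
    and "B \<inter> \<Union>(set Ws) \<subseteq> hd Ws"
  shows "smooth_bags k (B # Ws)"
proof -
  have "card ((B # Ws) ! i \<inter> (B # Ws) ! (i + 1)) = k" if "i + 1 < length (B # Ws)" for i
    using that assms by (cases i) (auto simp: smooth_bags_def hd_conv_nth)
  then show ?thesis using assms by (simp add: smooth_bags_def interval_bags_Cons)
qed

text \<open>The induction removes from the first bag a vertex occurring in no other bag, smooths the rest,
  and puts the vertex back in a new first bag. The conclusion \<open>hd Vs \<subseteq> hd Ws\<close> makes this possible:
  it lets the new bag contain the old one.\<close>

lemma smooth_refinement:
  assumes "Vs \<noteq> []" and "interval_bags Vs" and "finite (\<Union>(set Vs))"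
    and "\<forall>B\<in>set Vs. card B \<le> k + 1" and "k + 1 \<le> card (\<Union>(set Vs))"
  shows "\<exists>Ws. smooth_bags k Ws \<and> \<Union>(set Ws) = \<Union>(set Vs) \<and> hd Vs \<subseteq> hd Ws \<and>
           (\<forall>V\<in>set Vs. \<exists>W\<in>set Ws. V \<subseteq> W)"
  using assms
\<comment> \<open>Dropping a redundant first bag lowers the length, removing a private vertex lowers
  the number of vertices; the sum decreases in both cases.\<close>
proof (induction "card (\<Union>(set Vs)) + length Vs" arbitrary: Vs rule: less_induct)
  case less
  show ?case
  proof (cases "card (\<Union>(set Vs)) = k + 1")
    case True
    \<comment> \<open>A single bag holding all \<open>k + 1\<close> vertices is smooth.\<close>
    then show ?thesis
      using less.prems(1)
      by (intro exI[of _ "[\<Union>(set Vs)]"]) (auto simp: smooth_bags_singleton intro: hd_in_set)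
  next
    case False
    \<comment> \<open>Strictness rules out a single bag and leaves at least \<open>k + 1\<close>
      vertices once one is removed, as the induction hypothesis demands.\<close>
    then have big: "k + 1 < card (\<Union>(set Vs))" using less.prems by simp
    obtain B Cs where Vs: "Vs = B # Cs" using less.prems(1) by (cases Vs) auto
    have Cs: "Cs \<noteq> []" using big less.prems(4) Vs by auto
    have int: "interval_bags Cs" "B \<inter> \<Union>(set Cs) \<subseteq> hd Cs"
      using less.prems(2) Cs by (auto simp: Vs interval_bags_Cons)
    have hdC: "hd Cs \<in> set Cs" using Cs by simp
    show ?thesis
    proof (cases "B \<subseteq> hd Cs")
      case True
      then have un: "\<Union>(set Vs) = \<Union>(set Cs)" using Vs hdC by auto
      have "\<exists>Ws. smooth_bags k Ws \<and> \<Union>(set Ws) = \<Union>(set Cs) \<and> hd Cs \<subseteq> hd Ws \<and>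
           (\<forall>V\<in>set Cs. \<exists>W\<in>set Ws. V \<subseteq> W)"
      proof (rule less.hyps)
        show "card (\<Union>(set Cs)) + length Cs < card (\<Union>(set Vs)) + length Vs"
          unfolding un using Vs by simp
        show "\<forall>B\<in>set Cs. card B \<le> k + 1" using less.prems(4) Vs by simp
      qed (use Cs int(1) less.prems(3,5) un in simp_all)
      then obtain Ws where "smooth_bags k Ws" "\<Union>(set Ws) = \<Union>(set Cs)" "hd Cs \<subseteq> hd Ws"
        "\<forall>V\<in>set Cs. \<exists>W\<in>set Ws. V \<subseteq> W"
        by blast
      moreover from this have "\<exists>W\<in>set Ws. B \<subseteq> W" using hdC True by (meson subset_trans)
      moreover from calculation have "hd Vs \<subseteq> hd Ws" using True Vs by simp
      ultimately show ?thesis unfolding un by (intro exI[of _ Ws]) (simp add: Vs)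
    next
      case False
      then obtain x where x: "x \<in> B" "x \<notin> hd Cs" by blast
      \<comment> \<open>By the interval condition a vertex missing from the second bag is missing
        from all later ones.\<close>
      then have xC: "x \<notin> \<Union>(set Cs)" using int(2) by blast
      let ?Vs = "(B - {x}) # Cs"
      have un: "\<Union>(set ?Vs) = \<Union>(set Vs) - {x}" using xC Vs by auto
      have xV: "x \<in> \<Union>(set Vs)" using x Vs by auto
      have finB: "finite B" using less.prems(3) Vs by simp
      have cB: "card (B - {x}) \<le> k"
        using less.prems(4)[rule_format, of B] Vs x(1) finB by (simp add: card_Diff_singleton)
      have cV: "card (\<Union>(set Vs) - {x}) = card (\<Union>(set Vs)) - 1"
        using xV less.prems(3) by (simp add: card_Diff_singleton)
      have "\<exists>Ws. smooth_bags k Ws \<and> \<Union>(set Ws) = \<Union>(set ?Vs) \<and> hd ?Vs \<subseteq> hd Ws \<and>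
           (\<forall>V\<in>set ?Vs. \<exists>W\<in>set Ws. V \<subseteq> W)"
      proof (rule less.hyps)
        show "card (\<Union>(set ?Vs)) + length ?Vs < card (\<Union>(set Vs)) + length Vs"
          unfolding un cV using big Vs by simp
        show "interval_bags ?Vs" using Cs int by (auto simp: interval_bags_Cons)
        show "finite (\<Union>(set ?Vs))" unfolding un using less.prems(3) by simp
        show "\<forall>B\<in>set ?Vs. card B \<le> k + 1" using cB less.prems(4) Vs by auto
        show "k + 1 \<le> card (\<Union>(set ?Vs))" unfolding un cV using big by simp
      qed simp
      then obtain Ws where Ws: "smooth_bags k Ws" "\<Union>(set Ws) = \<Union>(set Vs) - {x}"
        "B - {x} \<subseteq> hd Ws" "\<forall>V\<in>set ?Vs. \<exists>W\<in>set Ws. V \<subseteq> W"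
        unfolding un by auto
      have hdW: "hd Ws \<in> set Ws" using Ws(1) by (simp add: smooth_bags_def)
      then have cW: "card (hd Ws) = k + 1" using Ws(1) by (simp add: smooth_bags_def)
      \<comment> \<open>Infinite sets have \<open>card\<close> 0, so a positive cardinality forces
        finiteness.\<close>
      then have finW: "finite (hd Ws)" using card.infinite by fastforce
      \<comment> \<open>\<open>S\<close> enlarges \<open>B - {x}\<close> to exactly \<open>k\<close>
        elements inside the first smoothed bag. Then \<open>insert x S\<close> has
        \<open>k + 1\<close> elements, contains \<open>B\<close>, and overlaps that bag in
        \<open>S\<close>.\<close>
      obtain S where S: "B - {x} \<subseteq> S" "S \<subseteq> hd Ws" "card S = k"
        using exists_subset_between[OF cB _ Ws(3) finW] cW by auto
      have xS: "x \<notin> S" "x \<notin> hd Ws" using S(2) Ws(2) hdW by auto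
      have finS: "finite S" using S(2) finW finite_subset by blast
      have "smooth_bags k (insert x S # Ws)"
      proof (rule smooth_bags_Cons[OF Ws(1)])
        show "card (insert x S) = k + 1" using xS finS S(3) by simp
        have "insert x S \<inter> hd Ws = S" using xS S(2) by auto
        then show "card (insert x S \<inter> hd Ws) = k" using S(3) by simp
        show "insert x S \<inter> \<Union>(set Ws) \<subseteq> hd Ws" using S(2) Ws(2) by auto
      qed
      moreover have "S \<subseteq> \<Union>(set Vs) - {x}" using S(2) hdW unfolding Ws(2)[symmetric] by blast
      then have "insert x S \<union> (\<Union>(set Vs) - {x}) = insert x (\<Union>(set Vs))" by blast
      then have "\<Union>(set (insert x S # Ws)) = \<Union>(set Vs)"
        by (simp only: list.set Union_insert Ws(2) insert_absorb[OF xV])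
      moreover have "hd Vs \<subseteq> insert x S" using S(1) Vs by auto
      moreover have "\<forall>V\<in>set Vs. \<exists>W\<in>set (insert x S # Ws). V \<subseteq> W"
        using Ws(4) S(1) x(1) unfolding Vs by (simp add: subset_insert_iff)
      ultimately show ?thesis
        by (intro exI[of _ "insert x S # Ws"] conjI) (simp_all only: list.sel)
    qed
  qed
qed

section \<open>Path-decompositions and their lists of bags\<close>

lemma path_decompositionD:
  assumes "path_decomposition G Vs"
  shows "\<forall>B\<in>set Vs. B \<subseteq> verts G" and "\<forall>x\<in>verts G. \<exists>B\<in>set Vs. x \<in> B"
    and "\<forall>e\<in>edges G. \<exists>B\<in>set Vs. e \<subseteq> B"
    and "\<forall>x\<in>verts G. \<forall>i j l. i \<le> j \<and> j \<le> l \<and> l < length Vs \<and> x \<in> Vs ! i \<and> x \<in> Vs ! l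
           \<longrightarrow> x \<in> Vs ! j"
  using assms unfolding path_decomposition_def by - (elim conjE; assumption)+

lemma path_decomposition_Union:
  assumes "path_decomposition G Vs"
  shows "\<Union>(set Vs) = verts G"
proof
  show "\<Union>(set Vs) \<subseteq> verts G" using path_decompositionD(1)[OF assms] by (simp add: Sup_le_iff)
  show "verts G \<subseteq> \<Union>(set Vs)" using path_decompositionD(2)[OF assms] by (meson UnionI subsetI)
qed

lemma path_decomposition_nth_subset:
  "path_decomposition G Vs \<Longrightarrow> i < length Vs \<Longrightarrow> Vs ! i \<subseteq> verts G"
  using path_decompositionD(1) nth_mem by blast

lemma path_decomposition_in_nth:
  "path_decomposition G Vs \<Longrightarrow> x \<in> verts G \<Longrightarrow> \<exists>i<length Vs. x \<in> Vs ! i"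
  using path_decompositionD(2) by (metis in_set_conv_nth)

lemma path_decomposition_interval_bags:
  assumes "path_decomposition G Vs"
  shows "interval_bags Vs"
proof -
  have mid: "x \<in> Vs ! j"
    if "x \<in> verts G" "i \<le> j \<and> j \<le> l \<and> l < length Vs" "x \<in> Vs ! i \<inter> Vs ! l" for x i j l
    using path_decompositionD(4)[OF assms, rule_format, of x i j l] that by simp
  show ?thesis
    unfolding interval_bags_def
  proof (intro allI impI subsetI)
    fix i j l x assume *: "i \<le> j \<and> j \<le> l \<and> l < length Vs" and x: "x \<in> Vs ! i \<inter> Vs ! l"
    then have "x \<in> verts G" using path_decomposition_nth_subset[OF assms, of l] by blast
    then show "x \<in> Vs ! j" using mid[OF _ * x] by simp
  qed
qed

lemma path_decompositionI:
  assumes "\<Union>(set Vs) = verts G" and "\<And>e. e \<in> edges G \<Longrightarrow> \<exists>B\<in>set Vs. e \<subseteq> B"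
    and "interval_bags Vs"
  shows "path_decomposition G Vs"
  unfolding path_decomposition_def
proof (intro conjI)
  show "\<forall>B\<in>set Vs. B \<subseteq> verts G" "\<forall>x\<in>verts G. \<exists>B\<in>set Vs. x \<in> B"
    unfolding assms(1)[symmetric] by blast+
  show "\<forall>e\<in>edges G. \<exists>B\<in>set Vs. e \<subseteq> B" using assms(2) by blast
  show "\<forall>x\<in>verts G. \<forall>i j l. i \<le> j \<and> j \<le> l \<and> l < length Vs \<and> x \<in> Vs ! i \<and> x \<in> Vs ! l
      \<longrightarrow> x \<in> Vs ! j"
    by (meson interval_bagsD[OF assms(3)])
qed

section \<open>Path-width and the existence of smooth decompositions\<close>

lemma path_width_le: "path_decomposition G Vs \<Longrightarrow> path_width G \<le> pd_width Vs"
  unfolding path_width_def by (rule Least_le) blast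

text \<open>The one-bag decomposition shows that the minimum is taken over a non-empty set.\<close>

lemma path_width_attained:
  assumes "is_graph G"
  obtains Vs where "path_decomposition G Vs" "pd_width Vs = path_width G"
proof -
  have "path_decomposition G [verts G]"
    by (rule path_decompositionI) (auto simp: interval_bags_def is_graph_edge_subset[OF assms])
  then have "\<exists>Vs. path_decomposition G Vs \<and> pd_width Vs = pd_width [verts G]" by blast
  then have "\<exists>Vs. path_decomposition G Vs \<and> pd_width Vs = path_width G"
    unfolding path_width_def by (rule LeastI)
  then show ?thesis using that by metis
qed

lemma pd_width_const:
  assumes "Vs \<noteq> []" and "\<forall>B\<in>set Vs. card B = k + 1"
  shows "pd_width Vs = k"
proof -
  have "card ` set Vs = {k + 1}" using assms by (auto simp: image_iff neq_Nil_conv)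
  then show ?thesis by (simp add: pd_width_def)
qed

text \<open>Smooth the bags of an optimal decomposition. Each old bag lies in a new one, so edges
  stay covered; having at least \<open>k + 1\<close> vertices is what allows every bag to be
  full.\<close>

lemma exists_smooth_pd:
  assumes G: "is_graph G" and pw: "path_width G \<le> k" and big: "k + 1 \<le> card (verts G)"
  obtains Vs where "smooth_pd k G Vs" "Vs \<noteq> []"
proof -
  obtain Vs where Vs: "path_decomposition G Vs" "pd_width Vs \<le> k"
    using path_width_attained[OF G] pw by metis
  note un = path_decomposition_Union[OF Vs(1)]
  have ne: "Vs \<noteq> []" using un G by (auto simp: is_graph_def)
  have "card B \<le> k + 1" if "B \<in> set Vs" for B
  proof -
    have "card B \<le> Max (card ` set Vs)" using that by simp
    \<comment> \<open>Truncated subtraction is harmless: a maximum \<open>m\<close> with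
      \<open>m - 1 \<le> k\<close> satisfies \<open>m \<le> k + 1\<close> in any case.\<close>
    then show ?thesis using Vs(2) by (simp add: pd_width_def)
  qed
  then have "\<exists>Ws. smooth_bags k Ws \<and> \<Union>(set Ws) = \<Union>(set Vs) \<and> hd Vs \<subseteq> hd Ws \<and>
      (\<forall>V\<in>set Vs. \<exists>W\<in>set Ws. V \<subseteq> W)"
    using ne path_decomposition_interval_bags[OF Vs(1)] big G
    by (intro smooth_refinement) (simp_all add: un is_graph_def)
  then obtain Ws where Ws: "smooth_bags k Ws" "\<Union>(set Ws) = verts G"
    "\<forall>V\<in>set Vs. \<exists>W\<in>set Ws. V \<subseteq> W"
    unfolding un by blast
  have "path_decomposition G Ws"
  proof (rule path_decompositionI)
    fix e assume "e \<in> edges G"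
    then obtain V where "V \<in> set Vs" "e \<subseteq> V"
      using path_decompositionD(3)[OF Vs(1)] by blast
    then show "\<exists>B\<in>set Ws. e \<subseteq> B" using Ws(3) by (meson subset_trans)
  qed (use Ws(1,2) in \<open>simp_all add: smooth_bags_def\<close>)
  then have "smooth_pd k G Ws"
    using Ws(1) pd_width_const[of Ws k] by (auto simp: smooth_pd_def smooth_bags_def)
  then show ?thesis using that Ws(1) by (auto simp: smooth_bags_def)
qed

text \<open>On subsets of the vertex set, images under \<open>f\<close> commute with intersections
  and keep cardinalities; this transports the interval condition and the overlap sizes.\<close>

lemma smooth_pd_image_graph:
  assumes f: "inj_on f (verts G)" and sm: "smooth_pd k G Vs" and ne: "Vs \<noteq> []"
  shows "smooth_pd k (image_graph f G) (map (\<lambda>B. f ` B) Vs)"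
proof -
  let ?Vs = "map (\<lambda>B. f ` B) Vs"
  have pd: "path_decomposition G Vs" using sm by (simp add: smooth_pd_def)
  note un = path_decomposition_Union[OF pd]
  have sub: "Vs ! i \<subseteq> verts G" if "i < length Vs" for i
    using path_decomposition_nth_subset[OF pd that] .
  have inter: "f ` (Vs ! i) \<inter> f ` (Vs ! j) = f ` (Vs ! i \<inter> Vs ! j)"
    if "i < length Vs" "j < length Vs" for i j
    using inj_on_image_Int[OF f sub[OF that(1)] sub[OF that(2)]] by simp
  have card: "card (f ` A) = card A" if "A \<subseteq> verts G" for A
    using card_image[OF inj_on_subset[OF f that]] .
  have "path_decomposition (image_graph f G) ?Vs"
  proof (rule path_decompositionI)
    show "\<Union>(set ?Vs) = verts (image_graph f G)"
      by (simp add: un[symmetric] image_Union)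
    show "\<exists>B\<in>set ?Vs. e \<subseteq> B" if "e \<in> edges (image_graph f G)" for e
    proof -
      have "\<exists>e'\<in>edges G. e = f ` e'" using that by (simp add: image_iff)
      then obtain e' where e': "e = f ` e'" "e' \<in> edges G" ..
      then obtain B where "B \<in> set Vs" "e' \<subseteq> B" using path_decompositionD(3)[OF pd] by blast
      then show ?thesis using e'(1) by simp (meson image_mono)
    qed
    show "interval_bags ?Vs"
      unfolding interval_bags_def
    proof (intro allI impI)
      fix i j l assume *: "i \<le> j \<and> j \<le> l \<and> l < length ?Vs"
      then have "Vs ! i \<inter> Vs ! l \<subseteq> Vs ! j"
        using path_decomposition_interval_bags[OF pd] by (simp add: interval_bags_def)
      then show "?Vs ! i \<inter> ?Vs ! l \<subseteq> ?Vs ! j"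
        using * inter[of i l] by (simp add: image_mono)
    qed
  qed
  moreover have "\<forall>B\<in>set ?Vs. card B = k + 1"
    using sm path_decompositionD(1)[OF pd] card by (simp add: smooth_pd_def)
  moreover have "card (?Vs ! i \<inter> ?Vs ! (i + 1)) = k" if "i + 1 < length ?Vs" for i
  proof -
    have "card (Vs ! i \<inter> Vs ! (i + 1)) = k" using sm that by (simp add: smooth_pd_def)
    then show ?thesis using that inter[of i "i + 1"] card[of "Vs ! i \<inter> Vs ! (i + 1)"] sub[of i]
      by (simp add: le_infI1)
  qed
  ultimately show ?thesis using pd_width_const[of ?Vs k] ne by (simp add: smooth_pd_def)
qed

text \<open>Two sets of size \<open>k + 1\<close> sharing \<open>k\<close> elements differ by one
  element each way: \<open>x\<close> enters and \<open>u\<close> leaves, which is the move made in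
  step 2(b) of the algorithm.\<close>

lemma smooth_pd_exchange:
  assumes sm: "smooth_pd k G Vs" and i: "Suc i < length Vs"
  obtains x u where "Vs ! Suc i - Vs ! i = {x}" "Vs ! i - Vs ! Suc i = {u}"
proof -
  have c: "card (Vs ! i) = k + 1" "card (Vs ! Suc i) = k + 1" "card (Vs ! i \<inter> Vs ! Suc i) = k"
    using sm i by (auto simp: smooth_pd_def)
  then have "finite (Vs ! i)" "finite (Vs ! Suc i)" using card.infinite by fastforce+
  then have "card (Vs ! Suc i - Vs ! i) = 1" "card (Vs ! i - Vs ! Suc i) = 1"
    using c card_Diff_subset_Int[of "Vs ! Suc i" "Vs ! i"]
      card_Diff_subset_Int[of "Vs ! i" "Vs ! Suc i"] by (auto simp: Int_commute)
  then show ?thesis using that by (auto simp: card_1_singleton_iff)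
qed

text \<open>An earlier occurrence would, by the interval condition, put \<open>x\<close> into the
  bag just before. So entering vertices are fresh.\<close>

lemma smooth_pd_new_vertex:
  assumes sm: "smooth_pd k G Vs" and i: "Suc i < length Vs" and x: "x \<in> Vs ! Suc i - Vs ! i"
  shows "x \<notin> (\<Union>j\<le>i. Vs ! j)"
proof
  assume "x \<in> (\<Union>j\<le>i. Vs ! j)"
  then obtain j where "j \<le> i" "x \<in> Vs ! j" by auto
  moreover have "interval_bags Vs"
    using sm by (auto simp: smooth_pd_def intro: path_decomposition_interval_bags)
  ultimately have "x \<in> Vs ! i" using interval_bagsD[of Vs j i "Suc i" x] i x by auto
  then show False using x by simp
qed

lemma UN_atMost_Suc_insert:
  assumes "A (Suc i) - A i = {x}"
  shows "(\<Union>j\<le>Suc i. A j) = insert x (\<Union>j\<le>i. A j)"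
proof -
  have "A (Suc i) \<subseteq> insert x (A i)" "x \<in> A (Suc i)" "A i \<subseteq> (\<Union>j\<le>i. A j)"
    using assms by blast+
  then show ?thesis unfolding atMost_Suc UN_insert by blast
qed

text \<open>Each bag after the first contributes one fresh vertex. The algorithm recovers its
  position from this count.\<close>

lemma smooth_pd_card_prefix:
  assumes sm: "smooth_pd k G Vs"
  shows "i < length Vs \<Longrightarrow> card (\<Union>j\<le>i. Vs ! j) = k + 1 + i"
proof (induction i)
  case 0
  then show ?case using sm by (simp add: smooth_pd_def)
next
  case (Suc i)
  obtain x where x: "Vs ! Suc i - Vs ! i = {x}" using smooth_pd_exchange[OF sm Suc.prems] .
  then have "x \<notin> (\<Union>j\<le>i. Vs ! j)" using smooth_pd_new_vertex[OF sm Suc.prems] by blast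
  moreover have "(\<Union>j\<le>Suc i. Vs ! j) = insert x (\<Union>j\<le>i. Vs ! j)"
    using x by (rule UN_atMost_Suc_insert)
  moreover have "finite (\<Union>j\<le>i. Vs ! j)"
    using Suc by (intro card_ge_0_finite) simp
  ultimately show ?case using Suc by simp
qed

section \<open>Renaming the vertices\<close>

text \<open>Vertices are named by the bag in which they enter. In the first bag, \<open>k\<close> of
  them receive the names \<open>un\<close> in any order and the remaining one becomes
  \<open>vn 1\<close>. Bags count from 0, so the vertex entering at bag \<open>Suc i\<close> is
  \<open>vn (i + 2)\<close>.\<close>

lemma exists_renaming:
  assumes sm: "smooth_pd k G Vs" and ne: "Vs \<noteq> []"
    and un: "inj_on un {1..k}" and vn: "inj_on vn {1..}" and disj: "un ` {1..k} \<inter> vn ` {1..} = {}"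
  obtains f where "inj_on f (verts G)" "f ` (Vs ! 0) = insert (vn 1) (un ` {1..k})"
    "\<And>i. Suc i < length Vs \<Longrightarrow> f ` (Vs ! Suc i - Vs ! i) = {vn (i + 2)}"
proof -
  have pd: "path_decomposition G Vs" using sm by (simp add: smooth_pd_def)
  have V0: "card (Vs ! 0) = k + 1" using sm ne by (simp add: smooth_pd_def)
  then obtain y where y: "y \<in> Vs ! 0" by fastforce
  have fin: "finite (Vs ! 0)" using V0 card.infinite by fastforce
  let ?A = "Vs ! 0 - {y}"
  have "card ?A = card (un ` {1..k})" using V0 y fin card_image[OF un] by simp
  then obtain g where g: "bij_betw g ?A (un ` {1..k})"
    using finite_same_card_bij[of ?A "un ` {1..k}"] fin by auto
  \<comment> \<open>0-based index of the bag in which \<open>v\<close> enters;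
    \<open>first v + 1\<close> is the index of its name.\<close>
  define first where "first v = (LEAST i. v \<in> Vs ! i)" for v
  define f where "f v = (if v \<in> ?A then g v else vn (first v + 1))" for v
  have first0: "v \<in> Vs ! 0 \<longleftrightarrow> first v = 0" if "v \<in> verts G" for v
  proof -
    have "\<exists>i. v \<in> Vs ! i" using path_decomposition_in_nth[OF pd that] by blast
    then have "v \<in> Vs ! first v" unfolding first_def by (rule LeastI_ex)
    then show ?thesis by (auto simp: first_def intro: Least_equality)
  qed
  have sub: "Vs ! i \<subseteq> verts G" if "i < length Vs" for i
    using path_decomposition_nth_subset[OF pd that] .
  have firstSuc: "\<exists>i. Suc i < length Vs \<and> first v = Suc i \<and> v \<in> Vs ! Suc i - Vs ! i"
    if "v \<in> verts G" "v \<notin> Vs ! 0" for v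
  proof -
    from path_decomposition_in_nth[OF pd \<open>v \<in> verts G\<close>]
    obtain l where l: "l < length Vs" "v \<in> Vs ! l" by blast
    \<comment> \<open>The bound by \<open>l\<close> keeps \<open>first v\<close> inside the list,
      where \<open>nth\<close> is meaningful.\<close>
    then have "v \<in> Vs ! first v" "first v \<le> l"
      unfolding first_def by (auto intro: LeastI Least_le)
    moreover have "first v \<noteq> 0" using first0 that by simp
    then obtain i where i: "first v = Suc i" using not0_implies_Suc by blast
    moreover have "v \<notin> Vs ! i" using i not_less_Least[of i "\<lambda>i. v \<in> Vs ! i"] by (auto simp: first_def)
    ultimately show ?thesis using l(1) by auto
  qed
  have new: "first v = Suc i" if "Suc i < length Vs" "v \<in> Vs ! Suc i - Vs ! i" for i v
    unfolding first_def
  proof (rule Least_equality)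
    show "Suc i \<le> j" if "v \<in> Vs ! j" for j
      using smooth_pd_new_vertex[OF sm \<open>Suc i < length Vs\<close> \<open>v \<in> Vs ! Suc i - Vs ! i\<close>] that
      by (meson UN_I atMost_iff not_less_eq_eq)
  qed (use that in auto)
  have gA: "g v \<in> un ` {1..k}" if "v \<in> ?A" for v using g that by (auto simp: bij_betw_def)
  \<comment> \<open>Outside \<open>?A\<close> the entry bag determines the vertex: only
    \<open>y\<close> remains at index 0, and exactly one vertex enters at each later index.\<close>
  have inj_first: "v = w"
    if "v \<in> verts G - ?A" "w \<in> verts G - ?A" "first v = first w" for v w
  proof (cases "first v = 0")
    case True
    then show ?thesis using that first0 by auto
  next
    case False
    then have "v \<notin> Vs ! 0" "w \<notin> Vs ! 0" using that first0 by auto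
    then have "\<exists>i. Suc i < length Vs \<and> {v, w} \<subseteq> Vs ! Suc i - Vs ! i"
      using firstSuc[of v] firstSuc[of w] that by auto
    then obtain i where i: "Suc i < length Vs" "{v, w} \<subseteq> Vs ! Suc i - Vs ! i" by blast
    then show ?thesis using smooth_pd_exchange[OF sm i(1)] by (metis insert_subset singletonD)
  qed
  have "inj_on f (verts G)"
  proof (rule inj_onI)
    fix v w assume vw: "v \<in> verts G" "w \<in> verts G" "f v = f w"
    have vnin: "vn (first z + 1) \<in> vn ` {1..}" for z by simp
    \<comment> \<open>The two mixed cases would give a common value of \<open>un\<close> and
      \<open>vn\<close>, against disjointness.\<close>
    consider "v \<in> ?A" "w \<in> ?A" | "v \<notin> ?A" "w \<notin> ?A" | "v \<in> ?A" "w \<notin> ?A" | "v \<notin> ?A" "w \<in> ?A"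
      by blast
    then show "v = w"
    proof cases
      case 1
      then show ?thesis using vw(3) g by (auto simp: f_def bij_betw_def dest: inj_onD)
    next
      case 2
      then have "vn (first v + 1) = vn (first w + 1)" using vw(3) by (simp only: f_def if_False)
      then have "first v + 1 = first w + 1" by (rule inj_onD[OF vn]) auto
      then show ?thesis using inj_first 2 vw by simp
    next
      case 3
      then have "g v = vn (first w + 1)" using vw(3) by (simp only: f_def if_True if_False)
      then show ?thesis using gA[OF 3(1)] vnin[of w] disj by (metis IntI empty_iff)
    next
      case 4
      then have "g w = vn (first v + 1)" using vw(3) by (simp only: f_def if_True if_False)
      then show ?thesis using gA[OF 4(2)] vnin[of v] disj by (metis IntI empty_iff)
    qed
  qed
  moreover have "f ` (Vs ! 0) = insert (vn 1) (un ` {1..k})"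
  proof -
    have "f ` ?A = un ` {1..k}" using g by (auto simp: f_def bij_betw_def)
    moreover have "first y = 0" using first0 y sub ne by auto
    then have "f y = vn 1" by (simp add: f_def)
    moreover have "Vs ! 0 = insert y ?A" using y by auto
    ultimately show ?thesis by (metis image_insert)
  qed
  moreover have "f ` (Vs ! Suc i - Vs ! i) = {vn (i + 2)}" if i: "Suc i < length Vs" for i
  proof -
    obtain x where x: "Vs ! Suc i - Vs ! i = {x}" using smooth_pd_exchange[OF sm i] .
    then have "first x = Suc i" using new i by blast
    moreover from this have "x \<notin> Vs ! 0" using first0[of x] sub[OF i] x by auto
    ultimately show ?thesis using x by (simp add: f_def)
  qed
  ultimately show ?thesis using that by blast
qed

section \<open>The pairs of a smooth path-decomposition\<close>

lemma verts_assoc_graph: "verts (assoc_graph G Vs i) = (\<Union>j\<le>i. Vs ! j)"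
  by (simp add: assoc_graph_def del_edges_def induced_def)

lemma edges_assoc_graph:
  "edges (assoc_graph G Vs i) = {e \<in> edges G. e \<subseteq> (\<Union>j\<le>i. Vs ! j) \<and> \<not> e \<subseteq> Vs ! i}"
  by (auto simp: assoc_graph_def del_edges_def induced_def)

lemma assoc_graph_0: "assoc_graph G Vs 0 = (Vs ! 0, {})"
  by (rule prod_eqI) (simp_all add: verts_assoc_graph edges_assoc_graph)

text \<open>The bags up to index \<open>i\<close> decompose the graph, since the added edges fit
  into bag \<open>i\<close>. Hence any graph tested in step 2(a) has path-width at most
  \<open>k\<close>.\<close>

lemma path_width_assoc_graph_add_edges:
  assumes sm: "smooth_pd k G Vs" and i: "i < length Vs" and E': "E' \<subseteq> pairs_of (Vs ! i)"
  shows "path_width (add_edges (assoc_graph G Vs i) E') \<le> k"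
proof -
  let ?H = "add_edges (assoc_graph G Vs i) E'" and ?Ws = "take (Suc i) Vs"
  have pd: "path_decomposition G Vs" using sm by (simp add: smooth_pd_def)
  note int = path_decomposition_interval_bags[OF pd]
  have set: "set ?Ws = (\<lambda>j. Vs ! j) ` {..i}"
    using i nth_image[of "Suc i" Vs] by (simp add: lessThan_Suc_atMost[symmetric] atLeast0LessThan)
  have "path_decomposition ?H ?Ws"
  proof (rule path_decompositionI)
    show "\<Union>(set ?Ws) = verts ?H"
      unfolding set by (simp add: add_edges_def verts_assoc_graph)
    show "interval_bags ?Ws" using int by (auto simp: interval_bags_def)
    fix e assume "e \<in> edges ?H"
    then consider "e \<in> E'" | "e \<in> edges (assoc_graph G Vs i)" by (auto simp: add_edges_def)
    then show "\<exists>B\<in>set ?Ws. e \<subseteq> B"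
    proof cases
      case 1
      then show ?thesis unfolding set using E' pairs_of_subset by blast
    next
      case 2
      then have e: "e \<in> edges G" "e \<subseteq> (\<Union>j\<le>i. Vs ! j)" "\<not> e \<subseteq> Vs ! i"
        by (auto simp: edges_assoc_graph)
      obtain l where l: "l < length Vs" "e \<subseteq> Vs ! l"
        using path_decompositionD(3)[OF pd] e(1) by (metis in_set_conv_nth)
      \<comment> \<open>If only a later bag covered \<open>e\<close>, its ends, which also occur up
        to bag \<open>i\<close>, would all lie in bag \<open>i\<close>; but edges inside that bag
        were deleted.\<close>
      have "l \<le> i"
      proof (rule ccontr)
        assume "\<not> l \<le> i"
        then have "e \<subseteq> Vs ! i" using e(2) l interval_bagsD[OF int, of _ i l] by fastforce
        then show False using e(3) by simp
      qed
      then show ?thesis unfolding set using l(2) by blast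
    qed
  qed
  moreover have "pd_width ?Ws = k"
    using i sm by (intro pd_width_const) (auto simp: smooth_pd_def dest: in_set_takeD)
  ultimately show ?thesis using path_width_le by metis
qed

text \<open>At the last bag all vertices are present and only the edges inside that bag are
  missing.\<close>

lemma assoc_graph_last:
  assumes "is_graph G" and pd: "path_decomposition G Vs" and i: "Suc i = length Vs"
  shows "add_edges (assoc_graph G Vs i) {e \<in> edges G. e \<subseteq> Vs ! i} = G"
proof -
  have "(\<Union>j\<le>i. Vs ! j) = \<Union>(set Vs)"
    using nth_image[of "Suc i" Vs] i by (simp add: lessThan_Suc_atMost[symmetric] atLeast0LessThan)
  then have un: "(\<Union>j\<le>i. Vs ! j) = verts G" using path_decomposition_Union[OF pd] by simp
  show ?thesis
    using is_graph_edge_subset[OF assms(1)]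
    by (intro prod_eqI) (auto simp: add_edges_def verts_assoc_graph edges_assoc_graph un)
qed

text \<open>When \<open>u\<close> leaves, its edges inside the old bag cease to be hidden. Edges
  from the entering vertex to earlier ones lie inside the new bag and so stay hidden.\<close>

lemma edges_assoc_graph_Suc:
  assumes G: "is_graph G" and sm: "smooth_pd k G Vs" and i: "Suc i < length Vs"
    and u: "Vs ! i - Vs ! Suc i = {u}"
  shows "edges (assoc_graph G Vs (Suc i)) =
    edges (assoc_graph G Vs i) \<union> {{u, y} | y. y \<in> Vs ! i - {u} \<and> {u, y} \<in> edges G}"
    (is "?L = ?R")
proof
  have pd: "path_decomposition G Vs" using sm by (simp add: smooth_pd_def)
  note int = path_decomposition_interval_bags[OF pd]
  have un: "(\<Union>j\<le>Suc i. Vs ! j) = Vs ! Suc i \<union> (\<Union>j\<le>i. Vs ! j)" by (simp add: atMost_Suc)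
  \<comment> \<open>A vertex of the new bag seen before was already in the old bag, so an edge not
    inside the old bag cannot lie inside the new one.\<close>
  have sep: "z \<in> Vs ! i" if "z \<in> Vs ! Suc i" "z \<in> (\<Union>j\<le>i. Vs ! j)" for z
    using smooth_pd_new_vertex[OF sm i] that by blast
  show "?L \<subseteq> ?R"
  proof
    fix e assume "e \<in> ?L"
    then have e: "e \<in> edges G" "e \<subseteq> (\<Union>j\<le>Suc i. Vs ! j)" "\<not> e \<subseteq> Vs ! Suc i"
      by (auto simp: edges_assoc_graph)
    obtain l where l: "l < length Vs" "e \<subseteq> Vs ! l"
      using path_decompositionD(3)[OF pd] e(1) by (metis in_set_conv_nth)
    have "l \<le> i"
    proof (rule ccontr)
      assume "\<not> l \<le> i"
      then have "e \<subseteq> Vs ! Suc i" using e(2) l interval_bagsD[OF int, of _ "Suc i" l] by fastforce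
      then show False using e(3) by simp
    qed
    then have e_old: "e \<subseteq> (\<Union>j\<le>i. Vs ! j)" using l(2) by blast
    show "e \<in> ?R"
    proof (cases "e \<subseteq> Vs ! i")
      case True
      \<comment> \<open>Only \<open>u\<close> was lost between the two bags, so an edge inside the
        old but not the new one contains \<open>u\<close>.\<close>
      then have "u \<in> e" using e(3) u by (metis DiffI singletonD subsetD subsetI)
      moreover have "e \<in> pairs_of (verts G)" using G e(1) unfolding is_graph_def by blast
      then obtain a b where "e = {a, b}" "a \<noteq> b" unfolding pairs_of_def by blast
      ultimately obtain y where "e = {u, y}" "y \<noteq> u" by (auto simp: insert_commute)
      then show ?thesis using True e(1) by auto
    qed (use e(1) e_old in \<open>simp add: edges_assoc_graph\<close>)
  qed
  have u_in: "u \<in> Vs ! i" "u \<notin> Vs ! Suc i" using u by auto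
  show "?R \<subseteq> ?L"
  proof
    fix e assume "e \<in> ?R"
    then consider "e \<in> edges (assoc_graph G Vs i)"
      | y where "e = {u, y}" "y \<in> Vs ! i" "e \<in> edges G" by auto
    then show "e \<in> ?L"
    proof cases
      case 1
      then have "e \<in> edges G" "e \<subseteq> (\<Union>j\<le>i. Vs ! j)" "\<not> e \<subseteq> Vs ! i"
        by (auto simp: edges_assoc_graph)
      moreover from this have "\<not> e \<subseteq> Vs ! Suc i" using sep by blast
      ultimately show ?thesis unfolding edges_assoc_graph un by blast
    next
      case 2
      then show ?thesis unfolding edges_assoc_graph un using u_in by blast
    qed
  qed
qed

text \<open>With the leaving vertex \<open>u\<close> and its neighbours in the old bag as
  \<open>Y\<close>, one extension step follows the decomposition.\<close>

lemma extend_pair_assoc_graph: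
  assumes G: "is_graph G" and sm: "smooth_pd k G Vs" and i: "Suc i < length Vs"
    and u: "Vs ! i - Vs ! Suc i = {u}" and x: "Vs ! Suc i - Vs ! i = {vn (i + 2)}"
  shows "extend_pair vn k (Vs ! i, assoc_graph G Vs i) (u, {y \<in> Vs ! i - {u}. {u, y} \<in> edges G}) =
    (Vs ! Suc i, assoc_graph G Vs (Suc i))"
proof -
  \<comment> \<open>The counter \<open>card (verts H) - k\<close> equals \<open>i + 1\<close> at
    0-based bag \<open>i\<close>, so the new vertex is \<open>vn (i + 2)\<close>.\<close>
  have "card (verts (assoc_graph G Vs i)) - k + 1 = i + 2"
    using smooth_pd_card_prefix[OF sm, of i] i by (simp add: verts_assoc_graph)
  moreover have "insert (vn (i + 2)) (Vs ! i - {u}) = Vs ! Suc i" using u x by blast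
  moreover have "insert (vn (i + 2)) (\<Union>j\<le>i. Vs ! j) = (\<Union>j\<le>Suc i. Vs ! j)"
    using UN_atMost_Suc_insert[of "\<lambda>j. Vs ! j", OF x] by simp
  ultimately show ?thesis
    using edges_assoc_graph_Suc[OF G sm i u]
    by (simp add: extend_pair_def Let_def add_edges_def add_vertex_def verts_assoc_graph prod_eq_iff)
qed

section \<open>Correctness of the algorithm\<close>

text \<open>Induction along the run. That every queued pair occurs in a member of
  \<open>\<G>\<close> is an invariant because \<open>keep_pair\<close> checks it; at the return it
  bounds the path-width.\<close>

lemma tus_loop_sound:
  assumes "tus_loop vn \<G> \<U> k Q r" and "\<forall>P\<in>set Q. \<exists>G\<in>\<G>. contains_pair k G P" and "r = Some G"
  shows "G \<in> pw_at_most \<G> k - super \<U>"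
  using assms
proof induction
  case empty_queue
  then show ?case by simp
next
  case (return_graph E' U H Q)
  obtain G' Vs i where "smooth_pd k G' Vs" "i < length Vs" "U = Vs ! i" "H = assoc_graph G' Vs i"
    using return_graph.prems by (auto simp: contains_pair_def)
  then have "path_width (add_edges H E') \<le> k"
    using path_width_assoc_graph_add_edges return_graph.hyps(1) by blast
  then show ?case using return_graph by (auto simp: pw_at_most_def)
next
  case (extend U H cs Q r)
  show ?case
  proof (rule extend.IH)
    show "\<forall>P\<in>set (Q @ filter (keep_pair \<G> \<U> k) (map (extend_pair vn k (U, H)) cs)).
        \<exists>G\<in>\<G>. contains_pair k G P"
    proof
      fix P assume "P \<in> set (Q @ filter (keep_pair \<G> \<U> k) (map (extend_pair vn k (U, H)) cs))"
      then consider "P \<in> set Q" | "keep_pair \<G> \<U> k P" by (simp only: set_append set_filter) blast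
      then show "\<exists>G\<in>\<G>. contains_pair k G P"
        using extend.prems(1) by cases (simp_all only: keep_pair_def list.set insert_iff simp_thms)
    qed
  qed (rule extend.prems(2))
qed

text \<open>Induction along the run: a pair of the decomposition at the head of the queue either
  triggers a return, if it is the last, or puts its successor into the next queue, against the
  induction hypothesis.\<close>

lemma tus_loop_None_no_pair:
  assumes "tus_loop vn \<G> \<U> k Q r" and "r = None"
    and G: "is_graph G" "G \<in> \<G>" "G \<notin> super \<U>" and sm: "smooth_pd k G Vs"
    and names: "\<And>i. Suc i < length Vs \<Longrightarrow> Vs ! Suc i - Vs ! i = {vn (i + 2)}"
  shows "\<forall>i<length Vs. (Vs ! i, assoc_graph G Vs i) \<notin> set Q"
  using assms(1,2)
proof induction
  case (extend U H cs Q r)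
  have pd: "path_decomposition G Vs" using sm by (simp add: smooth_pd_def)
  have "(U, H) \<noteq> (Vs ! i, assoc_graph G Vs i)" if i: "i < length Vs" for i
  proof
    assume UH: "(U, H) = (Vs ! i, assoc_graph G Vs i)"
    show False
    proof (cases "Suc i < length Vs")
      case False
      \<comment> \<open>Restoring these edges gives \<open>G\<close>, which passes the test of step
        2(a), whereas \<open>extend\<close> requires that no edge set passes.\<close>
      let ?E' = "{e \<in> edges G. e \<subseteq> Vs ! i}"
      have "?E' \<subseteq> pairs_of U"
        using G(1) UH by (auto simp: is_graph_def intro: pairs_of_restrict)
      moreover have "add_edges H ?E' = G"
        using assoc_graph_last[OF G(1) pd, of i] False i UH by simp
      ultimately show False using extend.hyps(1) G by (metis DiffI)
    next
      case True
      let ?P = "(Vs ! Suc i, assoc_graph G Vs (Suc i))"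
      obtain u where u: "Vs ! i - Vs ! Suc i = {u}" using smooth_pd_exchange[OF sm True] .
      let ?c = "(u, {y \<in> Vs ! i - {u}. {u, y} \<in> edges G})"
      have c: "?c \<in> set cs" using extend.hyps(3) UH u by auto
      have "?P = extend_pair vn k (U, H) ?c"
        using extend_pair_assoc_graph[where vn = vn, OF G(1) sm True u names[OF True]] UH by simp
      then have "?P \<in> extend_pair vn k (U, H) ` set cs" using c by (rule image_eqI)
      \<comment> \<open>The associated graph is a subgraph of \<open>G\<close> and so avoids
        \<open>super \<U>\<close>; \<open>G\<close> itself is the required member containing the
        pair.\<close>
      moreover have "keep_pair \<G> \<U> k ?P"
      proof -
        have "verts (assoc_graph G Vs (Suc i)) \<subseteq> verts G"
          using True path_decomposition_Union[OF pd]
          by (fastforce simp: verts_assoc_graph)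
        moreover have "edges (assoc_graph G Vs (Suc i)) \<subseteq> edges G"
          by (auto simp: edges_assoc_graph)
        ultimately have "assoc_graph G Vs (Suc i) \<notin> super \<U>"
          using super_mono[OF _ G(1)] G(3) by blast
        moreover have "contains_pair k G ?P" using sm True by (auto simp: contains_pair_def)
        ultimately show ?thesis using G(2) by (auto simp: keep_pair_def)
      qed
      ultimately have "?P \<in> set (Q @ filter (keep_pair \<G> \<U> k) (map (extend_pair vn k (U, H)) cs))"
        unfolding set_append set_filter set_map by (intro UnI2 CollectI conjI)
      with extend.IH[OF extend.prems, rule_format, OF True] show False by (rule notE)
    qed
  qed
  moreover have "(Vs ! i, assoc_graph G Vs i) \<notin> set Q" if "i < length Vs" for i
    using extend.IH[OF extend.prems, rule_format, OF that] by simp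
  ultimately show ?case by (metis set_ConsD)
qed simp_all

theorem theorem9:
  fixes k :: nat
    and \<G> \<U> :: "'a graph set"
    and un vn :: "nat \<Rightarrow> 'a"
  assumes "inj_on un {1..k}" and "inj_on vn {1..}" and "un ` {1..k} \<inter> vn ` {1..} = {}"
    and "graph_class \<G>"
    and "\<forall>G\<in>\<G>. k + 1 \<le> card (verts G)"
    and "finite \<U>" and "\<forall>X\<in>\<U>. is_graph X"
  shows "(\<forall>G. tus_returns un vn \<G> \<U> k (Some G) \<longrightarrow> G \<in> pw_at_most \<G> k - super \<U>) \<and>
         (tus_returns un vn \<G> \<U> k None \<longrightarrow> pw_at_most \<G> k \<subseteq> super \<U>)"
proof (intro conjI allI impI subsetI)
  let ?P = "initial_pair un vn k"
  let ?Q = "if good_pair \<G> \<U> k ?P then [] else [?P]"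
  {
    fix G assume "tus_returns un vn \<G> \<U> k (Some G)"
    \<comment> \<open>If the initial pair is queued, it is not good, and a counterexample to
      goodness is a member containing it.\<close>
    moreover have "\<forall>P\<in>set ?Q. \<exists>G\<in>\<G>. contains_pair k G P"
      by (auto simp: good_pair_def pw_at_most_def)
    ultimately show "G \<in> pw_at_most \<G> k - super \<U>"
      unfolding tus_returns_def using tus_loop_sound by blast
  next
    fix G assume None: "tus_returns un vn \<G> \<U> k None" and "G \<in> pw_at_most \<G> k"
    then have G: "is_graph G" "G \<in> \<G>" "path_width G \<le> k" "k + 1 \<le> card (verts G)"
      using assms(4,5) by (auto simp: pw_at_most_def graph_class_def)
    obtain Vs where Vs: "smooth_pd k G Vs" "Vs \<noteq> []" using exists_smooth_pd[OF G(1,3,4)] .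
    obtain f where f: "inj_on f (verts G)" "f ` (Vs ! 0) = insert (vn 1) (un ` {1..k})"
      "\<And>i. Suc i < length Vs \<Longrightarrow> f ` (Vs ! Suc i - Vs ! i) = {vn (i + 2)}"
      using exists_renaming[OF Vs assms(1-3)] by metis
    \<comment> \<open>The copy of \<open>G\<close> whose vertices carry the names of the algorithm;
      it stays in \<open>\<G>\<close> by closure under isomorphism.\<close>
    define G' where "G' = image_graph f G"
    define Ws where "Ws = map (\<lambda>B. f ` B) Vs"
    have sm: "smooth_pd k G' Ws"
      using smooth_pd_image_graph[OF f(1) Vs] by (simp add: G'_def Ws_def)
    have "is_graph G'" "graph_iso G G'"
      using is_graph_image_graph[OF G(1) f(1)] graph_iso_image_graph[OF f(1)]
      by (simp_all add: G'_def)
    then have G': "is_graph G'" "G' \<in> \<G>" using assms(4) G(2) unfolding graph_class_def by blast+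
    have names: "Ws ! Suc i - Ws ! i = {vn (i + 2)}" if "Suc i < length Ws" for i
    proof -
      have "Vs ! i \<subseteq> verts G" "Vs ! Suc i \<subseteq> verts G"
        using path_decomposition_nth_subset[of G Vs] Vs(1) that by (simp_all add: smooth_pd_def Ws_def)
      then have "f ` (Vs ! Suc i - Vs ! i) = f ` (Vs ! Suc i) - f ` (Vs ! i)"
        using inj_on_image_set_diff[OF f(1)] by blast
      then show ?thesis using f(3) that by (simp add: Ws_def)
    qed
    have P: "?P = (Ws ! 0, assoc_graph G' Ws 0)"
      using f(2) Vs(2) by (simp add: initial_pair_def assoc_graph_0 Ws_def)
    have len: "0 < length Ws" using Vs(2) by (simp add: Ws_def)
    \<comment> \<open>The transported decomposition bounds the path-width of the copy
      directly.\<close>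
    have "path_width G' \<le> k" using path_width_le sm unfolding smooth_pd_def by metis
    then have pw: "G' \<in> pw_at_most \<G> k" using G'(2) by (simp add: pw_at_most_def)
    have "G' \<in> super \<U>"
    proof (rule ccontr)
      assume no: "G' \<notin> super \<U>"
      have "contains_pair k G' ?P" using P sm len by (auto simp: contains_pair_def)
      \<comment> \<open>\<open>G'\<close> witnesses that the initial pair is not good, so the run
        starts with this pair in the queue.\<close>
      then have "?P \<in> set ?Q" using no pw by (auto simp: good_pair_def)
      moreover have "\<forall>i<length Ws. (Ws ! i, assoc_graph G' Ws i) \<notin> set ?Q"
        using tus_loop_None_no_pair[OF _ refl G' no sm names] None unfolding tus_returns_def by blast
      ultimately show False using len P by auto
    qed
    then show "G \<in> super \<U>" using super_image_graphD[OF G(1) f(1)] by (simp add: G'_def)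
  }
qed

end
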